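(* Let $\mathscr{A}=(\mathscr{A},f,g)$ be a commutative Krasner $(m,n)$-hyperring with scalar identity $1_{\mathscr{A}}$, let $S$ be an $n$-ary multiplicative subset of $\mathscr{A}$ containing $1_{\mathscr{A}}$, and let $P$ be an $n$-ary $S$-hyperideal of $\mathscr{A}$. If $Q$ is a minimal $n$-ary prime hyperideal of $\mathscr{A}$ over $P$ (that is, minimal with respect to inclusion among the $n$-ary prime hyperideals of $\mathscr{A}$ containing $P$), then $Q$ is an $n$-ary $S$-hyperideal of $\mathscr{A}$.
   Context: Let $m,n\ge 2$. Notation: $p_i^j$ denotes the sequence $p_i,\dots,p_j$ (empty if $j<i$); $p^{(k)}$ denotes $p$ repeated $k$ times; for non-empty subsets, $f(P_1^m)=\bigcup\{f(p_1^m)\mid p_i\in P_i\}$ and similarly for $g$; singletons are identified with elements. A canonical $m$-ary hypergroup $(\mathscr{A},f)$ is a set with $f:\mathscr{A}^m\to\{\text{non-empty subsets of }\mathscr{A}\}$ such that: $f$ is associative ($f(p_1^{i-1},f(p_i^{m+i-1}),p_{m+i}^{2m-1})$ is independent of $i$) and invariant under permutations of its arguments; there is a unique $0$ with $f(p,0^{(m-1)})=\{p\}$ for all $p$; each $p$ has a unique $-p$ with $0\in f(p,-p,0^{(m-2)})$; and $p\in f(p_1^m)$ implies $p_i\in f(p,-p_1,\dots,-p_{i-1},-p_{i+1},\dots,-p_m)$ for each $i$. A commutative Krasner $(m,n)$-hyperring with scalar identity $1_{\mathscr{A}}$ is $(\mathscr{A},f,g)$ with $(\mathscr{A},f)$ a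 canonical $m$-ary hypergroup, $g:\mathscr{A}^n\to\mathscr{A}$ an associative operation invariant under permutations of its arguments, $g$ distributive over $f$ in each argument ($g(p_1^{i-1},f(q_1^m),p_{i+1}^n)=f(g(p_1^{i-1},q_1,p_{i+1}^n),\dots,g(p_1^{i-1},q_m,p_{i+1}^n))$), $g(0,p_2^n)=0$, and $g(p,1_{\mathscr{A}}^{(n-1)})=p$ for all $p$. A hyperideal is a non-empty $P\subseteq\mathscr{A}$ with $f(p_1^m)\subseteq P$ and $-p\in P$ for all $p,p_1,\dots,p_m\in P$, and $g(p_1^{i-1},P,p_{i+1}^n)\subseteq P$ for all $p_j\in\mathscr{A}$ and all $i$; it is proper if $P\ne\mathscr{A}$. A proper hyperideal $P$ is $n$-ary prime if $g(p_1^n)\in P$ implies $p_i\in P$ for some $i$. An $n$-ary multiplicative subset is a non-empty $S\subseteq\mathscr{A}$ with $g(s_1^n)\in S$ for all $s_1,\dots,s_n\in S$. Given such $S$, an $n$-ary $S$-hyperideal is a proper hyperideal $P$ such that whenever $g(p_1^n)\in P$ with $p_1,\dots,p_n\in\mathscr{A}$ and $p_i\in S$ for some $i$, then $g(p_1^{i-1},1_{\mathscr{A}},p_{i+1}^n)\in P$. *)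

theory Defs
  imports "HOL-Library.Multiset"
begin

text \<open>
  An \<open>m\<close>-ary (hyper)operation on \<open>A\<close> is a function on lists; only its values on lists of length \<open>m\<close>
  with entries in \<open>A\<close> matter. Argument positions are counted from \<open>0\<close>.
\<close>

definition tuples :: "nat \<Rightarrow> 'a set \<Rightarrow> 'a list set" where
  "tuples k A = {ps. length ps = k \<and> set ps \<subseteq> A}"

definition lift_hyperop :: "('a list \<Rightarrow> 'a set) \<Rightarrow> 'a set list \<Rightarrow> 'a set" where
  "lift_hyperop f Ps = (\<Union>ps \<in> listset Ps. f ps)"

definition lift_op :: "('a list \<Rightarrow> 'a) \<Rightarrow> 'a set list \<Rightarrow> 'a set" where
  "lift_op g Ps = {g ps | ps. ps \<in> listset Ps}"

abbreviation singletons :: "'a list \<Rightarrow> 'a set list" where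
  "singletons \<equiv> map (\<lambda>p. {p})"

definition is_zero :: "nat \<Rightarrow> 'a set \<Rightarrow> ('a list \<Rightarrow> 'a set) \<Rightarrow> 'a \<Rightarrow> bool" where
  "is_zero m A f z \<longleftrightarrow> z \<in> A \<and> (\<forall>p\<in>A. f (p # replicate (m - 1) z) = {p})"

definition hzero :: "nat \<Rightarrow> 'a set \<Rightarrow> ('a list \<Rightarrow> 'a set) \<Rightarrow> 'a" where
  "hzero m A f = (THE z. is_zero m A f z)"

definition is_neg :: "nat \<Rightarrow> 'a set \<Rightarrow> ('a list \<Rightarrow> 'a set) \<Rightarrow> 'a \<Rightarrow> 'a \<Rightarrow> bool" where
  "is_neg m A f p q \<longleftrightarrow>
     q \<in> A \<and> hzero m A f \<in> f (p # q # replicate (m - 2) (hzero m A f))"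

definition hneg :: "nat \<Rightarrow> 'a set \<Rightarrow> ('a list \<Rightarrow> 'a set) \<Rightarrow> 'a \<Rightarrow> 'a" where
  "hneg m A f p = (THE q. is_neg m A f p q)"

locale canonical_hypergroup =
  fixes m :: nat and A :: "'a set" and f :: "'a list \<Rightarrow> 'a set"
  assumes m_ge_2: "2 \<le> m"
    and f_closed: "ps \<in> tuples m A \<Longrightarrow> f ps \<noteq> {} \<and> f ps \<subseteq> A"
    and f_assoc: "\<lbrakk>ps \<in> tuples (2 * m - 1) A; i < m; j < m\<rbrakk> \<Longrightarrow>
      lift_hyperop f (singletons (take i ps) @ [f (take m (drop i ps))] @ singletons (drop (i + m) ps)) =
      lift_hyperop f (singletons (take j ps) @ [f (take m (drop j ps))] @ singletons (drop (j + m) ps))"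
    and f_perm: "\<lbrakk>ps \<in> tuples m A; mset qs = mset ps\<rbrakk> \<Longrightarrow> f qs = f ps"
    and ex1_zero: "\<exists>!z. is_zero m A f z"
    and ex1_neg: "p \<in> A \<Longrightarrow> \<exists>!q. is_neg m A f p q"
    and reversible: "\<lbrakk>ps \<in> tuples m A; p \<in> f ps; i < m\<rbrakk> \<Longrightarrow>
      ps ! i \<in> f (p # map (hneg m A f) (take i ps @ drop (Suc i) ps))"

locale comm_krasner_hyperring = canonical_hypergroup m A f
  for m n :: nat and A :: "'a set" and f :: "'a list \<Rightarrow> 'a set"
    and g :: "'a list \<Rightarrow> 'a" and e :: 'a +
  assumes n_ge_2: "2 \<le> n"
    and g_closed: "ps \<in> tuples n A \<Longrightarrow> g ps \<in> A"
    and g_assoc: "\<lbrakk>ps \<in> tuples (2 * n - 1) A; i < n; j < n\<rbrakk> \<Longrightarrow>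
      g (take i ps @ [g (take n (drop i ps))] @ drop (i + n) ps) =
      g (take j ps @ [g (take n (drop j ps))] @ drop (j + n) ps)"
    and g_perm: "\<lbrakk>ps \<in> tuples n A; mset qs = mset ps\<rbrakk> \<Longrightarrow> g qs = g ps"
    and distrib: "\<lbrakk>ps \<in> tuples n A; i < n; qs \<in> tuples m A\<rbrakk> \<Longrightarrow>
      lift_op g ((singletons ps)[i := f qs]) = f (map (\<lambda>q. g (ps[i := q])) qs)"
    and g_zero: "ps \<in> tuples (n - 1) A \<Longrightarrow> g (hzero m A f # ps) = hzero m A f"
    and one_closed: "e \<in> A"
    and g_one: "p \<in> A \<Longrightarrow> g (p # replicate (n - 1) e) = p"

definition hyperideal ::
  "nat \<Rightarrow> nat \<Rightarrow> 'a set \<Rightarrow> ('a list \<Rightarrow> 'a set) \<Rightarrow> ('a list \<Rightarrow> 'a) \<Rightarrow> 'a set \<Rightarrow> bool" where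
  "hyperideal m n A f g P \<longleftrightarrow>
     P \<noteq> {} \<and> P \<subseteq> A \<and>
     (\<forall>ps \<in> tuples m P. f ps \<subseteq> P) \<and>
     (\<forall>p\<in>P. hneg m A f p \<in> P) \<and>
     (\<forall>ps \<in> tuples n A. \<forall>i<n. lift_op g ((singletons ps)[i := P]) \<subseteq> P)"

definition proper_hyperideal ::
  "nat \<Rightarrow> nat \<Rightarrow> 'a set \<Rightarrow> ('a list \<Rightarrow> 'a set) \<Rightarrow> ('a list \<Rightarrow> 'a) \<Rightarrow> 'a set \<Rightarrow> bool" where
  "proper_hyperideal m n A f g P \<longleftrightarrow> hyperideal m n A f g P \<and> P \<noteq> A"

definition nary_prime ::
  "nat \<Rightarrow> nat \<Rightarrow> 'a set \<Rightarrow> ('a list \<Rightarrow> 'a set) \<Rightarrow> ('a list \<Rightarrow> 'a) \<Rightarrow> 'a set \<Rightarrow> bool" where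
  "nary_prime m n A f g P \<longleftrightarrow>
     proper_hyperideal m n A f g P \<and>
     (\<forall>ps \<in> tuples n A. g ps \<in> P \<longrightarrow> (\<exists>i<n. ps ! i \<in> P))"

definition nary_multiplicative :: "nat \<Rightarrow> 'a set \<Rightarrow> ('a list \<Rightarrow> 'a) \<Rightarrow> 'a set \<Rightarrow> bool" where
  "nary_multiplicative n A g S \<longleftrightarrow>
     S \<noteq> {} \<and> S \<subseteq> A \<and> (\<forall>ss \<in> tuples n S. g ss \<in> S)"

definition nary_S_hyperideal ::
  "nat \<Rightarrow> nat \<Rightarrow> 'a set \<Rightarrow> ('a list \<Rightarrow> 'a set) \<Rightarrow> ('a list \<Rightarrow> 'a) \<Rightarrow> 'a \<Rightarrow> 'a set \<Rightarrow> 'a set \<Rightarrow> bool" where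
  "nary_S_hyperideal m n A f g e S P \<longleftrightarrow>
     proper_hyperideal m n A f g P \<and>
     (\<forall>ps \<in> tuples n A. \<forall>i<n. g ps \<in> P \<and> ps ! i \<in> S \<longrightarrow> g (ps[i := e]) \<in> P)"

definition minimal_nary_prime_over ::
  "nat \<Rightarrow> nat \<Rightarrow> 'a set \<Rightarrow> ('a list \<Rightarrow> 'a set) \<Rightarrow> ('a list \<Rightarrow> 'a) \<Rightarrow> 'a set \<Rightarrow> 'a set \<Rightarrow> bool" where
  "minimal_nary_prime_over m n A f g P Q \<longleftrightarrow>
     nary_prime m n A f g Q \<and> P \<subseteq> Q \<and>
     (\<forall>Q'. nary_prime m n A f g Q' \<and> P \<subseteq> Q' \<and> Q' \<subseteq> Q \<longrightarrow> Q' = Q)"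

end

theory Submission imports Defs begin

text \<open>
  It suffices that \<open>Q\<close> is disjoint from \<open>S\<close>. The set \<open>T\<close> of all products of an element outside
  \<open>Q\<close> with an element of \<open>S\<close> is multiplicatively closed, and it misses \<open>P\<close> because factors from
  \<open>S\<close> can be cancelled in \<open>P\<close>. A hyperideal that contains \<open>P\<close> and is maximal among those missing
  \<open>T\<close> is prime and lies in \<open>Q\<close>, so it is \<open>Q\<close> by minimality; hence \<open>Q\<close> misses \<open>T\<close>, which contains \<open>S\<close>.

  Filling up with the scalar identity reduces \<open>g\<close> to a binary commutative monoid operation.
\<close>

section \<open>Lists of sets and finite subsets of unions of chains\<close>

lemma listset_singletons_update:
  assumes "i < length ps"
  shows "listset ((singletons ps)[i := B]) = {ps[i := b] | b. b \<in> B}"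
proof -
  have single: "listset (singletons qs) = {qs}" for qs :: "'a list"
    by (induction qs) (auto simp: set_Cons_def)
  show ?thesis using assms
  proof (induction ps arbitrary: i)
    case (Cons p ps)
    show ?case
    proof (cases i)
      case 0
      then show ?thesis by (auto simp: single set_Cons_def)
    next
      case (Suc j)
      then have "listset ((singletons ps)[j := B]) = {ps[j := b] | b. b \<in> B}"
        using Cons by simp
      then show ?thesis using Suc by (auto simp: set_Cons_def)
    qed
  qed simp
qed

text \<open>Turns the set-valued products in \<open>distrib\<close> and in the definition of a
  hyperideal into plain images in one variable argument.\<close>

lemma lift_op_singletons_update:
  assumes "i < length ps"
  shows "lift_op g ((singletons ps)[i := B]) = (\<lambda>b. g (ps[i := b])) ` B"
  unfolding lift_op_def listset_singletons_update[OF assms] by auto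

lemma finite_subset_Union_chain_member:
  assumes "finite F" and "F \<subseteq> \<Union>C" and "C \<noteq> {}" and "subset.chain X C"
  shows "\<exists>B\<in>C. F \<subseteq> B"
  using assms
proof (induction F rule: finite_induct)
  case empty
  then show ?case by blast
next
  case (insert x F)
  then obtain B where B: "B \<in> C" "F \<subseteq> B" by auto
  from insert.prems obtain D where D: "D \<in> C" "x \<in> D" by blast
  have "B \<subseteq> D \<or> D \<subseteq> B"
    using B D insert.prems by (auto simp: subset_chain_def)
  then show ?case using B D by blast
qed

section \<open>The binary multiplication \<open>mul\<close> and its relation to \<open>g\<close> and
  \<open>f\<close>\<close>

context comm_krasner_hyperring
begin

abbreviation zero :: 'a where "zero \<equiv> hzero m A f"

abbreviation neg :: "'a \<Rightarrow> 'a" where "neg \<equiv> hneg m A f"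

definition mul :: "'a \<Rightarrow> 'a \<Rightarrow> 'a" where
  "mul a b = g (a # b # replicate (n - 2) e)"

lemma zero_closed: "zero \<in> A"
  using theI'[OF ex1_zero] by (auto simp: hzero_def is_zero_def)

lemma is_neg_hneg: "p \<in> A \<Longrightarrow> is_neg m A f p (neg p)"
  using theI'[OF ex1_neg] by (auto simp: hneg_def)

lemma hneg_closed: "p \<in> A \<Longrightarrow> neg p \<in> A"
  using is_neg_hneg by (auto simp: is_neg_def)

lemma hneg_unique: "p \<in> A \<Longrightarrow> is_neg m A f p q \<Longrightarrow> neg p = q"
  using ex1_neg is_neg_hneg by blast

lemma mul_closed: "a \<in> A \<Longrightarrow> b \<in> A \<Longrightarrow> mul a b \<in> A"
  unfolding mul_def using n_ge_2 one_closed by (intro g_closed) (auto simp: tuples_def)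

lemma mul_commute: "a \<in> A \<Longrightarrow> b \<in> A \<Longrightarrow> mul a b = mul b a"
  unfolding mul_def using n_ge_2 one_closed by (intro g_perm) (auto simp: tuples_def)

lemma replicate_diff_1: "replicate (n - 1) x = x # replicate (n - 2) x"
proof -
  have "n - 1 = Suc (n - 2)" using n_ge_2 by simp
  then show ?thesis by simp
qed

lemma mul_one: "a \<in> A \<Longrightarrow> mul a e = a"
  using g_one[of a] unfolding mul_def replicate_diff_1 .

lemma mul_zero: "a \<in> A \<Longrightarrow> mul a zero = zero"
proof -
  assume a: "a \<in> A"
  then have "a # replicate (n - 2) e \<in> tuples (n - 1) A"
    using n_ge_2 one_closed by (auto simp: tuples_def)
  then have "mul zero a = zero" unfolding mul_def by (rule g_zero)
  then show ?thesis using a by (simp add: mul_commute zero_closed)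
qed

lemma mul_assoc:
  assumes "a \<in> A" "b \<in> A" "c \<in> A"
  shows "mul (mul a b) c = mul a (mul b c)"
proof -
  define r where "r = replicate (n - 2) e"
  have len: "length r = n - 2" and r: "set r \<subseteq> A"
    using one_closed by (auto simp: r_def)
  \<comment> \<open>The first \<open>n\<close> and the last \<open>n\<close> entries of this word
    each hold two factors with identities between them, so associativity at positions 0 and
    \<open>n - 1\<close> compares the two bracketings.\<close>
  define ps where "ps = (a # r @ [b]) @ r @ [c]"
  have ps: "ps \<in> tuples (2 * n - 1) A"
    using assms r len n_ge_2 by (auto simp: ps_def tuples_def)
  have perm: "g (x # r @ [y]) = mul x y" if "x \<in> A" "y \<in> A" for x y
    unfolding mul_def r_def[symmetric]
    using that r len n_ge_2 by (intro g_perm) (auto simp: tuples_def)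
  have ps': "ps = (a # r) @ (b # r @ [c])" by (simp add: ps_def)
  have lens: "length (a # r @ [b]) = n" "length (a # r) = n - 1" "length (b # r @ [c]) = n"
    using len n_ge_2 by auto
  have "take n ps = a # r @ [b]" "drop n ps = r @ [c]"
    using lens(1) unfolding ps_def by (metis append_eq_conv_conj)+
  moreover have "take (n - 1) ps = a # r" "drop (n - 1) ps = b # r @ [c]"
    using lens(2) unfolding ps' by (metis append_eq_conv_conj)+
  moreover have "length ps = 2 * n - 1" using ps by (simp add: tuples_def)
  ultimately have "g (g (a # r @ [b]) # r @ [c]) = g (a # r @ [g (b # r @ [c])])"
    using g_assoc[OF ps, of 0 "n - 1"] n_ge_2 lens by simp
  then show ?thesis using assms mul_closed by (simp add: perm)
qed

text \<open>Padding gives \<open>g\<close> a meaning on lists shorter than \<open>n\<close>, which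
  is what permits induction on \<open>ps\<close>; the unpadded full length is the case used
  later.\<close>

lemma g_pad_eq_foldr_mul:
  assumes "set ps \<subseteq> A" and "length ps \<le> n"
  shows "g (ps @ replicate (n - length ps) e) = foldr mul ps e"
  using assms
proof (induction ps)
  case Nil
  then show ?case using g_one[OF one_closed] n_ge_2 by (simp add: replicate_Suc[symmetric] del: replicate_Suc)
next
  case (Cons a ps)
  define k where "k = n - Suc (length ps)"
  have k: "n - length ps = Suc k" "length ps + k = n - 1"
    using Cons.prems by (auto simp: k_def)
  define u where "u = ps @ replicate k e"
  have u: "length u = n - 1" "set u \<subseteq> A"
    using Cons.prems k one_closed by (auto simp: u_def)
  have IH: "g (u @ [e]) = foldr mul ps e"
    using Cons k by (simp add: u_def replicate_append_same)
  \<comment> \<open>Bracketing at position 0 gives \<open>g (a # u)\<close> padded by identities,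
    which is \<open>g (a # u)\<close> itself. Bracketing at position 1 gives \<open>mul a\<close>
    applied to \<open>g (u @ [e])\<close>, the value known by induction.\<close>
  define xs where "xs = a # u @ replicate (n - 1) e"
  have xs: "xs \<in> tuples (2 * n - 1) A"
    using Cons.prems u one_closed n_ge_2 by (auto simp: xs_def tuples_def)
  have xs1: "xs = (a # u) @ replicate (n - 1) e" by (simp add: xs_def)
  have xs2: "xs = a # (u @ [e]) @ replicate (n - 2) e" unfolding xs_def replicate_diff_1 by simp
  have lens: "length (a # u) = n" "length (u @ [e]) = n" using u n_ge_2 by auto
  have "take n xs = a # u" "drop n xs = replicate (n - 1) e"
    using lens(1) unfolding xs1 by (metis append_eq_conv_conj)+
  moreover have "take n (drop 1 xs) = u @ [e]" "drop (1 + n) xs = replicate (n - 2) e"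
    "take 1 xs = [a]"
    using lens(2) unfolding xs2 by (simp_all del: append_assoc)
  ultimately have "g (g (a # u) # replicate (n - 1) e) = g (a # g (u @ [e]) # replicate (n - 2) e)"
    using g_assoc[OF xs, of 0 1] n_ge_2 by simp
  moreover have "g (a # u) \<in> A"
    using Cons.prems lens u by (intro g_closed) (auto simp: tuples_def)
  ultimately have "g (a # u) = mul a (foldr mul ps e)"
    using g_one[of "g (a # u)"] by (simp add: IH mul_def)
  then show ?case by (simp add: u_def k_def)
qed

lemma g_eq_foldr_mul: "ps \<in> tuples n A \<Longrightarrow> g ps = foldr mul ps e"
  using g_pad_eq_foldr_mul[of ps] by (simp add: tuples_def)

lemma foldr_mul_closed: "set ps \<subseteq> A \<Longrightarrow> foldr mul ps e \<in> A"
  by (induction ps) (auto intro: mul_closed one_closed)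

lemma image_mul_f:
  assumes "a \<in> A" and "qs \<in> tuples m A"
  shows "mul a ` f qs = f (map (mul a) qs)"
proof -
  \<comment> \<open>The \<open>e\<close> at index 1 is a placeholder: distributivity is applied in
    that place, where \<open>mul a\<close> takes its argument.\<close>
  let ?ps = "a # e # replicate (n - 2) e"
  have ps: "?ps \<in> tuples n A"
    using assms one_closed n_ge_2 by (auto simp: tuples_def)
  have upd: "g (?ps[1 := q]) = mul a q" for q by (simp add: mul_def)
  have "1 < n" and "1 < length ?ps" using n_ge_2 by auto
  then have "(\<lambda>q. g (?ps[1 := q])) ` f qs = f (map (\<lambda>q. g (?ps[1 := q])) qs)"
    using distrib[OF ps _ assms(2)] lift_op_singletons_update by metis
  then show ?thesis unfolding upd .
qed

text \<open>Multiplying the relation that defines \<open>neg p\<close> by \<open>a\<close> shows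
  that \<open>mul a (neg p)\<close> is a negative of \<open>mul a p\<close>, and negatives are
  unique.\<close>

lemma mul_hneg:
  assumes "a \<in> A" and "p \<in> A"
  shows "mul a (neg p) = neg (mul a p)"
proof -
  let ?qs = "p # neg p # replicate (m - 2) zero"
  have "?qs \<in> tuples m A"
    using assms zero_closed hneg_closed m_ge_2 by (auto simp: tuples_def)
  then have "mul a ` f ?qs = f (mul a p # mul a (neg p) # replicate (m - 2) zero)"
    using assms by (simp add: image_mul_f mul_zero)
  moreover have "zero \<in> f ?qs"
    using is_neg_hneg[OF assms(2)] by (simp add: is_neg_def)
  ultimately have "zero \<in> f (mul a p # mul a (neg p) # replicate (m - 2) zero)"
    using mul_zero[OF assms(1)] by (metis imageI)
  then have "is_neg m A f (mul a p) (mul a (neg p))"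
    using assms by (simp add: is_neg_def mul_closed hneg_closed)
  then show ?thesis using assms by (simp add: hneg_unique mul_closed)
qed

text \<open>Only absorption is assumed of \<open>P\<close>, because the lemma serves to prove the
  characterization of hyperideals through \<open>mul\<close>.\<close>

lemma foldr_mul_absorb:
  assumes "\<And>a p. a \<in> A \<Longrightarrow> p \<in> P \<Longrightarrow> mul a p \<in> P" and "P \<subseteq> A"
    and "set ps \<subseteq> A" and "set ps \<inter> P \<noteq> {}"
  shows "foldr mul ps e \<in> P"
  using assms(3,4)
proof (induction ps)
  case (Cons a ps)
  show ?case
  proof (cases "a \<in> P")
    case True
    then have "mul (foldr mul ps e) a \<in> P"
      using assms(1) Cons.prems by (simp add: foldr_mul_closed)
    then show ?thesis using Cons.prems by (simp add: mul_commute foldr_mul_closed)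
  next
    case False
    then show ?thesis using Cons assms(1) by auto
  qed
qed simp

section \<open>Hyperideals in terms of \<open>mul\<close>, colon hyperideals and unions of
  chains\<close>

abbreviation ideal :: "'a set \<Rightarrow> bool" where "ideal \<equiv> hyperideal m n A f g"

text \<open>Forward, \<open>mul a p\<close> is a value of \<open>g\<close> on a word with
  \<open>p\<close> at index 1. Backward, \<open>g\<close> is an iterated \<open>mul\<close>, so a
  single factor in \<open>P\<close> draws the whole product into \<open>P\<close>.\<close>

lemma hyperideal_iff_mul:
  "ideal P \<longleftrightarrow> P \<noteq> {} \<and> P \<subseteq> A \<and> (\<forall>ps \<in> tuples m P. f ps \<subseteq> P) \<and> (\<forall>p\<in>P. neg p \<in> P) \<and>
     (\<forall>a\<in>A. \<forall>p\<in>P. mul a p \<in> P)"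
proof -
  have lift: "lift_op g ((singletons ps)[i := P]) = (\<lambda>p. g (ps[i := p])) ` P"
    if "ps \<in> tuples n A" "i < n" for ps i
    using that by (intro lift_op_singletons_update) (simp add: tuples_def)
  have "(\<forall>ps \<in> tuples n A. \<forall>i<n. lift_op g ((singletons ps)[i := P]) \<subseteq> P) \<longleftrightarrow>
     (\<forall>a\<in>A. \<forall>p\<in>P. mul a p \<in> P)" (is "?L \<longleftrightarrow> ?R") if PA: "P \<subseteq> A"
  proof
    assume L: ?L
    show ?R
    proof (intro ballI)
      fix a p assume "a \<in> A" "p \<in> P"
      let ?ps = "a # e # replicate (n - 2) e"
      have ps: "?ps \<in> tuples n A"
        using \<open>a \<in> A\<close> one_closed n_ge_2 by (auto simp: tuples_def)
      have "1 < n" using n_ge_2 by simp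
      then have "g (?ps[1 := p]) \<in> P"
        using L ps lift[OF ps, of 1] \<open>p \<in> P\<close> by blast
      then show "mul a p \<in> P" by (simp add: mul_def)
    qed
  next
    assume R: ?R
    show ?L
    proof (intro ballI allI impI)
      fix ps i assume ps: "ps \<in> tuples n A" and i: "i < n"
      have "g (ps[i := p]) \<in> P" if "p \<in> P" for p
      proof -
        have upd: "ps[i := p] \<in> tuples n A"
          using ps PA that set_update_subset_insert[of ps i p] by (auto simp: tuples_def)
        have "p \<in> set (ps[i := p])"
          using ps i by (simp add: tuples_def set_update_memI)
        then have "foldr mul (ps[i := p]) e \<in> P"
          using R PA upd that by (intro foldr_mul_absorb) (auto simp: tuples_def)
        then show ?thesis using upd by (simp add: g_eq_foldr_mul)
      qed
      then show "lift_op g ((singletons ps)[i := P]) \<subseteq> P"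
        using lift[OF ps i] by auto
    qed
  qed
  then show ?thesis unfolding hyperideal_def by blast
qed

lemma hyperideal_subset: "ideal P \<Longrightarrow> P \<subseteq> A"
  by (simp add: hyperideal_iff_mul)

lemma hyperideal_mul: "ideal P \<Longrightarrow> a \<in> A \<Longrightarrow> p \<in> P \<Longrightarrow> mul a p \<in> P"
  by (simp add: hyperideal_iff_mul)

lemma hyperideal_g:
  assumes "ideal P" and "ps \<in> tuples n A" and "i < n" and "ps ! i \<in> P"
  shows "g ps \<in> P"
proof -
  have ps: "set ps \<subseteq> A" "ps ! i \<in> set ps" using assms by (auto simp: tuples_def)
  then have "foldr mul ps e \<in> P"
    using assms(1,4) by (intro foldr_mul_absorb) (auto simp: hyperideal_iff_mul)
  then show ?thesis using assms by (simp add: g_eq_foldr_mul)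
qed

lemma one_notin_proper:
  assumes "proper_hyperideal m n A f g P"
  shows "e \<notin> P"
proof
  assume "e \<in> P"
  have "a \<in> P" if "a \<in> A" for a
    using hyperideal_mul[OF _ that \<open>e \<in> P\<close>] mul_one[OF that] assms
    by (simp add: proper_hyperideal_def)
  then show False
    using assms hyperideal_subset by (auto simp: proper_hyperideal_def)
qed

text \<open>The colon hyperideal (P : x). Closure under \<open>f\<close> and \<open>neg\<close>
  holds because \<open>mul x\<close> commutes with both. It provides the larger hyperideal to which
  maximality is applied below.\<close>

lemma hyperideal_colon:
  assumes P: "ideal P" and x: "x \<in> A"
  shows "ideal {r \<in> A. mul x r \<in> P}" (is "ideal ?C")
  unfolding hyperideal_iff_mul
proof (intro conjI ballI)
  have "P \<subseteq> ?C" using P x by (auto simp: hyperideal_iff_mul)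
  then show "?C \<noteq> {}" using P by (auto simp: hyperideal_iff_mul)
  show "?C \<subseteq> A" by blast
  show "neg p \<in> ?C" if "p \<in> ?C" for p
    using that P x by (auto simp: hyperideal_iff_mul mul_hneg hneg_closed)
  show "f ps \<subseteq> ?C" if "ps \<in> tuples m ?C" for ps
  proof -
    have ps: "ps \<in> tuples m A" using that by (auto simp: tuples_def)
    have "map (mul x) ps \<in> tuples m P" using that by (auto simp: tuples_def)
    then have "mul x ` f ps \<subseteq> P"
      using P x ps by (simp add: image_mul_f hyperideal_iff_mul)
    then show ?thesis using f_closed[OF ps] by auto
  qed
  show "mul a p \<in> ?C" if "a \<in> A" "p \<in> ?C" for a p
  proof -
    have "mul x (mul a p) = mul a (mul x p)"
      using that x mul_assoc[of x a p] mul_assoc[of a x p] mul_commute[of x a] by simp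
    then show ?thesis using that P x by (simp add: hyperideal_iff_mul mul_closed)
  qed
qed

text \<open>The arguments of \<open>f\<close> are finitely many, so they lie in a common member of
  the chain; the other closure conditions concern one element of the union at a time.\<close>

lemma hyperideal_Union_chain:
  assumes "C \<noteq> {}" and "subset.chain X C" and "\<And>I. I \<in> C \<Longrightarrow> ideal I"
  shows "ideal (\<Union>C)"
  unfolding hyperideal_iff_mul
proof (intro conjI ballI)
  show "\<Union>C \<noteq> {}" using assms by (auto simp: hyperideal_iff_mul)
  show "\<Union>C \<subseteq> A" using assms hyperideal_subset by blast
  show "neg p \<in> \<Union>C" if "p \<in> \<Union>C" for p
    using that assms(3) by (auto simp: hyperideal_iff_mul)
  show "mul a p \<in> \<Union>C" if "a \<in> A" "p \<in> \<Union>C" for a p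
    using that assms(3) hyperideal_mul by blast
  show "f ps \<subseteq> \<Union>C" if ps: "ps \<in> tuples m (\<Union>C)" for ps
  proof -
    obtain I where I: "I \<in> C" "set ps \<subseteq> I"
      using finite_subset_Union_chain_member[OF _ _ assms(1,2), of "set ps"] ps
      by (auto simp: tuples_def)
    then have "f ps \<subseteq> I"
      using assms(3)[OF I(1)] ps by (auto simp: hyperideal_iff_mul tuples_def)
    then show ?thesis using I by blast
  qed
qed

section \<open>Prime hyperideals avoiding a multiplicatively closed set (Krull's argument)\<close>

lemma ex_prime_avoiding_multiplicative:
  assumes P: "ideal P" and disj: "P \<inter> T = {}"
    and TA: "T \<subseteq> A" and eT: "e \<in> T"
    and T: "\<And>s t. s \<in> T \<Longrightarrow> t \<in> T \<Longrightarrow> mul s t \<in> T"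
  shows "\<exists>M. nary_prime m n A f g M \<and> P \<subseteq> M \<and> M \<inter> T = {}"
proof -
  define X where "X = {I. ideal I \<and> P \<subseteq> I \<and> I \<inter> T = {}}"
  have "\<Union>C \<in> X" if C: "C \<noteq> {}" "subset.chain X C" for C
  proof -
    have "C \<subseteq> X" using C by (simp add: subset_chain_def)
    then show ?thesis
      using hyperideal_Union_chain[OF C] C(1) unfolding X_def by blast
  qed
  moreover have "X \<noteq> {}" using P disj by (auto simp: X_def)
  ultimately obtain M where MX: "M \<in> X" and max: "\<And>I. I \<in> X \<Longrightarrow> M \<subseteq> I \<Longrightarrow> I = M"
    using subset_Zorn_nonempty[of X] by metis
  have M: "ideal M" "P \<subseteq> M" "M \<inter> T = {}" using MX by (auto simp: X_def)
  \<comment> \<open>The colon hyperideal (M : x) contains \<open>M\<close>, and properly so because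
    of \<open>y\<close>. By maximality of \<open>M\<close> it must meet \<open>T\<close>.\<close>
  have meets: "\<exists>t\<in>T. mul x t \<in> M" if "x \<in> A" "y \<in> A" "mul x y \<in> M" "y \<notin> M" for x y
  proof -
    let ?C = "{r \<in> A. mul x r \<in> M}"
    have "M \<subseteq> ?C" using M(1) that(1) by (auto simp: hyperideal_iff_mul)
    moreover have "?C \<noteq> M" using that by blast
    ultimately have "?C \<notin> X" using max by blast
    then show ?thesis
      using hyperideal_colon[OF M(1) that(1)] \<open>M \<subseteq> ?C\<close> M(2) by (auto simp: X_def)
  qed
  have prime: "x \<in> M \<or> y \<in> M" if x: "x \<in> A" and y: "y \<in> A" and xy: "mul x y \<in> M" for x y
  proof (rule ccontr)
    assume no: "\<not> (x \<in> M \<or> y \<in> M)"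
    \<comment> \<open>\<open>meets\<close> is used twice: first \<open>y\<close> is traded for some
      \<open>t\<close> in \<open>T\<close>, then \<open>x\<close> for some \<open>u\<close> in
      \<open>T\<close>. The product of \<open>t\<close> and \<open>u\<close> then lies in both
      \<open>M\<close> and \<open>T\<close>.\<close>
    then obtain t where t: "t \<in> T" "mul x t \<in> M" using meets x y xy by blast
    then have tA: "t \<in> A" using TA by blast
    then have "mul t x \<in> M" using t x by (simp add: mul_commute)
    then obtain u where "u \<in> T" "mul t u \<in> M" using meets[OF tA x] no by blast
    then show False using T t M(3) by blast
  qed
  have eM: "e \<notin> M" using eT M(3) by blast
  \<comment> \<open>Binary primeness extends to lists by induction; the empty product is
    \<open>e\<close>, which is in \<open>T\<close> and hence not in \<open>M\<close>.\<close>
  have "\<exists>p\<in>set ps. p \<in> M" if "set ps \<subseteq> A" "foldr mul ps e \<in> M" for ps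
    using that
  proof (induction ps)
    case (Cons a ps)
    then have "a \<in> M \<or> foldr mul ps e \<in> M" by (intro prime) (auto simp: foldr_mul_closed)
    then show ?case using Cons by auto
  qed (use eM in simp)
  then have "\<exists>i<n. ps ! i \<in> M" if "ps \<in> tuples n A" "g ps \<in> M" for ps
    using that g_eq_foldr_mul[OF that(1)] by (fastforce simp: tuples_def in_set_conv_nth)
  moreover have "M \<noteq> A" using eM one_closed by blast
  ultimately have "nary_prime m n A f g M"
    using M(1) by (simp add: nary_prime_def proper_hyperideal_def)
  then show ?thesis using M by blast
qed

text \<open>Primeness puts some entry of the padded word into \<open>Q\<close>; it is not a padding
  entry, since a proper hyperideal does not contain \<open>e\<close>.\<close>

lemma nary_prime_mul:
  assumes "nary_prime m n A f g Q" and "x \<in> A" and "y \<in> A" and "mul x y \<in> Q"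
  shows "x \<in> Q \<or> y \<in> Q"
proof -
  let ?ps = "x # y # replicate (n - 2) e"
  have ps: "?ps \<in> tuples n A" using assms n_ge_2 one_closed by (auto simp: tuples_def)
  then obtain i where i: "i < n" "?ps ! i \<in> Q"
    using assms(1,4) unfolding nary_prime_def mul_def by blast
  have "?ps ! i \<in> set ?ps"
    using i(1) ps by (intro nth_mem) (simp add: tuples_def)
  then have "?ps ! i \<in> {x, y, e}" by (auto split: if_splits)
  moreover have "e \<notin> Q" using assms(1) one_notin_proper by (simp add: nary_prime_def)
  ultimately show ?thesis using i by auto
qed

section \<open>Minimal primes over an S-hyperideal\<close>

lemma minimal_prime_disjoint:
  assumes S: "nary_multiplicative n A g S" and eS: "e \<in> S"
    and P: "nary_S_hyperideal m n A f g e S P"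
    and Q: "minimal_nary_prime_over m n A f g P Q"
  shows "Q \<inter> S = {}"
proof -
  have prime: "nary_prime m n A f g Q" and PQ: "P \<subseteq> Q"
    using Q by (auto simp: minimal_nary_prime_over_def)
  have eQ: "e \<in> A - Q"
    using prime one_notin_proper one_closed by (simp add: nary_prime_def)
  have SA: "S \<subseteq> A" using S by (simp add: nary_multiplicative_def)
  \<comment> \<open>Since \<open>e\<close> lies in \<open>S\<close>, the padded word is a word over
    \<open>S\<close>.\<close>
  have S_mul: "mul s t \<in> S" if "s \<in> S" "t \<in> S" for s t
  proof -
    have "s # t # replicate (n - 2) e \<in> tuples n S"
      using that eS n_ge_2 by (auto simp: tuples_def)
    then show ?thesis using S by (simp add: nary_multiplicative_def mul_def)
  qed
  \<comment> \<open>The S-condition at index 1 replaces \<open>s\<close> by \<open>e\<close>, which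
    leaves \<open>mul t e\<close>, that is \<open>t\<close>.\<close>
  have cancel: "t \<in> P" if "t \<in> A" "s \<in> S" "mul t s \<in> P" for t s
  proof -
    let ?ps = "t # s # replicate (n - 2) e"
    have "?ps \<in> tuples n A" using that SA n_ge_2 one_closed by (auto simp: tuples_def)
    moreover have "1 < n" "g ?ps \<in> P" "?ps ! 1 \<in> S" using that n_ge_2 by (auto simp: mul_def)
    ultimately have "g (?ps[1 := e]) \<in> P"
      using P unfolding nary_S_hyperideal_def by blast
    then show ?thesis using mul_one[OF that(1)] by (simp add: mul_def)
  qed
  \<comment> \<open>Taking \<open>s = e\<close> shows that \<open>T\<close> contains
    \<open>A - Q\<close>, so a hyperideal missing \<open>T\<close> lies in \<open>Q\<close>; taking
    \<open>t = e\<close> shows that \<open>T\<close> contains \<open>S\<close>.\<close>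
  define T where "T = {mul t s | t s. t \<in> A - Q \<and> s \<in> S}"
  have TA: "T \<subseteq> A" using SA by (auto simp: T_def intro: mul_closed)
  have compl: "A - Q \<subseteq> T" using eS mul_one unfolding T_def by force
  have ST: "S \<subseteq> T"
  proof
    fix s assume s: "s \<in> S"
    then have "s = mul e s" using SA mul_commute[OF one_closed, of s] mul_one[of s] by auto
    then show "s \<in> T" using s eQ unfolding T_def by blast
  qed
  have T_mul: "mul u v \<in> T" if uv: "u \<in> T" "v \<in> T" for u v
  proof -
    obtain a s b t where u: "u = mul a s" "a \<in> A - Q" "s \<in> S"
      and v: "v = mul b t" "b \<in> A - Q" "t \<in> S"
      using uv by (auto simp: T_def)
    have A: "a \<in> A" "s \<in> A" "b \<in> A" "t \<in> A" using u v SA by auto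
    have "mul u v = mul a (mul (mul s b) t)"
      using A by (simp add: u v mul_assoc mul_closed)
    also have "\<dots> = mul (mul a b) (mul s t)"
      using A by (simp add: mul_commute[of s b] mul_assoc mul_closed)
    finally have "mul u v = mul (mul a b) (mul s t)" .
    \<comment> \<open>Primeness of \<open>Q\<close> makes its complement closed under
      \<open>mul\<close>.\<close>
    moreover have "mul a b \<in> A - Q"
      using nary_prime_mul[OF prime] u v A by (auto intro: mul_closed)
    ultimately show ?thesis using S_mul u v unfolding T_def by blast
  qed
  have "P \<inter> T = {}" using cancel PQ unfolding T_def by blast
  moreover have "ideal P" using P by (simp add: nary_S_hyperideal_def proper_hyperideal_def)
  moreover have "e \<in> T" using ST eS by blast
  ultimately obtain M where M: "nary_prime m n A f g M" "P \<subseteq> M" "M \<inter> T = {}"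
    using ex_prime_avoiding_multiplicative[OF _ _ TA _ T_mul] by blast
  have "M \<subseteq> A"
    using M(1) hyperideal_subset by (simp add: nary_prime_def proper_hyperideal_def)
  then have "M \<subseteq> Q" using M(3) compl by blast
  then have "M = Q" using Q M by (simp add: minimal_nary_prime_over_def)
  then show ?thesis using M(3) ST by blast
qed

text \<open>Primeness yields an entry in \<open>Q\<close>, and it is not the one in
  \<open>S\<close>. So it survives the replacement by \<open>e\<close> and keeps the new product in
  \<open>Q\<close>.\<close>

lemma prime_disjoint_imp_S_hyperideal:
  assumes prime: "nary_prime m n A f g Q" and disj: "Q \<inter> S = {}"
  shows "nary_S_hyperideal m n A f g e S Q"
  unfolding nary_S_hyperideal_def
proof (intro conjI ballI allI impI)
  show proper: "proper_hyperideal m n A f g Q" using prime by (simp add: nary_prime_def)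
  fix ps i assume ps: "ps \<in> tuples n A" and i: "i < n" and asm: "g ps \<in> Q \<and> ps ! i \<in> S"
  then obtain j where j: "j < n" "ps ! j \<in> Q" using prime by (auto simp: nary_prime_def)
  then have "j \<noteq> i" using disj asm by blast
  then have "ps[i := e] ! j \<in> Q" using j by simp
  moreover have "ps[i := e] \<in> tuples n A"
    using ps one_closed set_update_subset_insert[of ps i e] by (auto simp: tuples_def)
  ultimately show "g (ps[i := e]) \<in> Q"
    using hyperideal_g j proper by (simp add: proper_hyperideal_def)
qed

end

theorem theorem3p6:
  fixes m n :: nat and A :: "'a set" and f :: "'a list \<Rightarrow> 'a set" and g :: "'a list \<Rightarrow> 'a"
    and e :: 'a and S P Q :: "'a set"
  assumes "comm_krasner_hyperring m n A f g e"
    and "nary_multiplicative n A g S" and "e \<in> S"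
    and "nary_S_hyperideal m n A f g e S P"
    and "minimal_nary_prime_over m n A f g P Q"
  shows "nary_S_hyperideal m n A f g e S Q"
proof -
  interpret comm_krasner_hyperring m n A f g e by fact
  show ?thesis
    using prime_disjoint_imp_S_hyperideal minimal_prime_disjoint[OF assms(2-5)] assms(5)
    by (simp add: minimal_nary_prime_over_def)
qed

end
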